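(* Let $\mathcal{A}\subseteq\mathcal{F}\setminus\{F_2\}$ with $\mathcal{A}\cap\{F_1,F_3,F_7\}\neq\emptyset$, where $\mathcal{F}=\{F_1,\dots,F_7\}$. Then $\mathrm{ex}(n,\mathcal{A})=\Theta(n^2)$ as $n\to\infty$.
   Context: A triple system $H=(V,E)$ has a finite vertex set $V$, and $E$ is a set of $3$-element subsets of $V$ (no repeated triples). For a family $\mathcal{H}$ of triple systems, $\mathrm{ex}(n,\mathcal{H})$ is the maximum number of triples in a triple system on $n$ vertices that does not contain (an isomorphic copy of) any member of $\mathcal{H}$ as a (not necessarily induced) subsystem. A special four cycle has four distinct base vertices $v_1,v_2,v_3,v_4$ and four triples $\{w_i,v_i,v_{i+1}\}$, $i=1,2,3,4$ (indices modulo $4$), where the $w_j$ are not necessarily distinct but $w_i\neq v_j$ for all $1\le i,j\le 4$. Up to isomorphism there are seven, forming $\mathcal{F}=\{F_1,\dots,F_7\}$, given by exactly the following coincidences among the $w_j$ (no other coincidences): $F_1$: all $w_j$ different; $F_2$: $w_1=w_2=w_3=w_4$; $F_3$: $w_1=w_2$ and $w_3=w_4$; $F_4$: $w_1=w_3$ and $w_2=w_4$ (the Pasch configuration); $F_5$: $w_1=w_2=w_3$; $F_6$: $w_1=w_3$; $F_7$: $w_1=w_2$. *)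

theory Defs
  imports Complex_Main "HOL-Library.Landau_Symbols"
begin

type_synonym 'a triple_sys = "'a set \<times> 'a set set"

abbreviation verts :: "'a triple_sys \<Rightarrow> 'a set" where
  "verts H \<equiv> fst H"

abbreviation triples :: "'a triple_sys \<Rightarrow> 'a set set" where
  "triples H \<equiv> snd H"

definition triple_system :: "'a triple_sys \<Rightarrow> bool" where
  "triple_system H \<longleftrightarrow> finite (verts H) \<and> (\<forall>e \<in> triples H. e \<subseteq> verts H \<and> card e = 3)"

definition contains_copy :: "'a triple_sys \<Rightarrow> 'b triple_sys \<Rightarrow> bool" where
  "contains_copy G H \<longleftrightarrow>
     (\<exists>f. inj_on f (verts H) \<and> f ` verts H \<subseteq> verts G \<and> (\<forall>e \<in> triples H. f ` e \<in> triples G))"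

text \<open>
  Every triple system on \<open>n\<close> vertices has an isomorphic copy whose vertices are natural numbers,
  so it suffices to range over those. The set below is finite, and it is nonempty as soon as every
  member of the family has at least one triple, so \<open>Max\<close> is a genuine maximum.
\<close>

definition ex_number :: "nat \<Rightarrow> 'b triple_sys set \<Rightarrow> nat" where
  "ex_number n \<H> = Max {card (triples G) | G :: nat triple_sys.
     triple_system G \<and> card (verts G) = n \<and> (\<forall>H \<in> \<H>. \<not> contains_copy G H)}"

text \<open>
  In a special four cycle the base vertices \<open>v\<^sub>i\<close> are distinct and no \<open>w\<^sub>i\<close> is a base vertex;
  the \<open>w\<^sub>i\<close> may coincide among themselves.
\<close>

definition special_four_cycle ::
    "'a \<Rightarrow> 'a \<Rightarrow> 'a \<Rightarrow> 'a \<Rightarrow> 'a \<Rightarrow> 'a \<Rightarrow> 'a \<Rightarrow> 'a \<Rightarrow> 'a triple_sys" where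
  "special_four_cycle v1 v2 v3 v4 w1 w2 w3 w4 =
     ({v1, v2, v3, v4} \<union> {w1, w2, w3, w4},
      {{w1, v1, v2}, {w2, v2, v3}, {w3, v3, v4}, {w4, v4, v1}})"

definition F1 :: "nat triple_sys" where "F1 = special_four_cycle 1 2 3 4  5 6 7 8"
definition F2 :: "nat triple_sys" where "F2 = special_four_cycle 1 2 3 4  5 5 5 5"
definition F3 :: "nat triple_sys" where "F3 = special_four_cycle 1 2 3 4  5 5 6 6"
definition F4 :: "nat triple_sys" where "F4 = special_four_cycle 1 2 3 4  5 6 5 6"
definition F5 :: "nat triple_sys" where "F5 = special_four_cycle 1 2 3 4  5 5 5 6"
definition F6 :: "nat triple_sys" where "F6 = special_four_cycle 1 2 3 4  5 6 5 7"
definition F7 :: "nat triple_sys" where "F7 = special_four_cycle 1 2 3 4  5 5 6 7"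

definition special_four_cycles :: "nat triple_sys set" where
  "special_four_cycles = {F1, F2, F3, F4, F5, F6, F7}"

end

theory Submission
  imports Defs
begin

text \<open>
  The lower bound comes from the star, all triples through one vertex. A copy of \<open>H\<close> in a
  star must send a vertex common to all triples of \<open>H\<close> to the centre, and among the special
  four cycles only \<open>F2\<close> has such a vertex.

  For the upper bound a single member \<open>F1\<close>, \<open>F3\<close> or \<open>F7\<close> of the family is enough. Deleting
  triples that contain a pair of small codegree or a vertex of small degree costs \<open>O(n\<^sup>2)\<close>
  triples (\<open>full_subsystem\<close>). In what remains, every covered pair has so many extensions that
  it can be completed to a triple by a vertex outside any few prescribed ones.

  \<^item> \<open>F1\<close>: two triples on a common pair already contain a four cycle of covered pairs, and its
    edges can be extended by new vertices. So nothing remains (\<open>F1_free_empty\<close>).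

  \<^item> \<open>F7\<close>: if \<open>x\<close> and \<open>y\<close> both extend the pair \<open>ab\<close>, a further vertex \<open>z\<close> covered together
    with \<open>x\<close> and together with \<open>y\<close> gives a copy. Hence, apart from \<open>a\<close> and \<open>b\<close>, the vertices
    covered together with the different extensions of \<open>ab\<close> form disjoint sets. If \<open>b\<close> has the
    fewest such neighbours, these disjoint sets are all about as large as the neighbourhood of
    \<open>b\<close> or larger, which bounds the degree of \<open>b\<close> by \<open>2n\<close>. So again nothing remains
    (\<open>F7_free_empty\<close>).

  \<^item> \<open>F3\<close>: the pairs in the common link of two vertices \<open>x\<close> and \<open>y\<close> pairwise intersect, so they
    form a triangle or share a vertex. So their number is at most \<open>3\<close>, or at most the codegree
    of a pair that contains \<open>x\<close>. Weighting each pair of the common link by the inverse of the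
    size of that link gives total weight at most \<open>1\<close> for each \<open>(x, y)\<close>, hence at most \<open>n\<^sup>2\<close>
    overall. On the other hand each triple \<open>abx\<close> whose pair \<open>ab\<close> has the largest codegree
    \<open>d\<close> among its pairs receives weight at least \<open>(d - 1) / d\<close> from the \<open>d - 1\<close> other
    extensions \<open>y\<close> of \<open>ab\<close> (\<open>F3_free_bound\<close>). So \<open>O(n\<^sup>2)\<close> triples remain.
\<close>

section \<open>Neighbourhoods, links and cleaning\<close>

definition nbhd :: "'a set set \<Rightarrow> 'a set \<Rightarrow> 'a set" where
  "nbhd E P = {y. y \<notin> P \<and> insert y P \<in> E}"

definition link :: "'a set set \<Rightarrow> 'a \<Rightarrow> 'a set set" where
  "link E x = {P. x \<notin> P \<and> insert x P \<in> E}"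

text \<open>
  As long as some \<open>S i\<close> is contained in at least one but fewer than \<open>t i\<close> members, all members
  that contain it are deleted. Each index triggers this at most once, since afterwards \<open>S i\<close> is
  contained in no member at all; so the total loss is at most the sum of the thresholds. The
  induction carries the sum over the indices that are still alive.
\<close>

lemma cleaning:
  fixes S :: "'i \<Rightarrow> 'a set" and t :: "'i \<Rightarrow> nat"
  assumes "finite I" and "finite E"
  obtains E' where "E' \<subseteq> E"
    and "\<And>i e. i \<in> I \<Longrightarrow> e \<in> E' \<Longrightarrow> S i \<subseteq> e \<Longrightarrow> t i \<le> card {e \<in> E'. S i \<subseteq> e}"
    and "card E \<le> card E' + sum t I"
proof -
  define active where "active E = {i \<in> I. \<exists>e \<in> E. S i \<subseteq> e}" for E
  have "\<exists>E' \<subseteq> E. (\<forall>i \<in> I. \<forall>e \<in> E'. S i \<subseteq> e \<longrightarrow> t i \<le> card {e \<in> E'. S i \<subseteq> e})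
      \<and> card E \<le> card E' + sum t (active E)"
    using \<open>finite E\<close>
  proof (induction "card E" arbitrary: E rule: less_induct)
    case less
    show ?case
    proof (cases "\<forall>i \<in> I. \<forall>e \<in> E. S i \<subseteq> e \<longrightarrow> t i \<le> card {e \<in> E. S i \<subseteq> e}")
      case True
      then show ?thesis by auto
    next
      case False
      then obtain i e where i: "i \<in> I" "e \<in> E" "S i \<subseteq> e" "card {e \<in> E. S i \<subseteq> e} < t i"
        by (meson not_le)
      define E1 where "E1 = {e \<in> E. \<not> S i \<subseteq> e}"
      have "E1 \<subset> E" using i unfolding E1_def by auto
      then have "card E1 < card E" "finite E1"
        using less.prems by (auto intro: psubset_card_mono finite_subset)
      then obtain E' where E': "E' \<subseteq> E1"
        "\<forall>i \<in> I. \<forall>e \<in> E'. S i \<subseteq> e \<longrightarrow> t i \<le> card {e \<in> E'. S i \<subseteq> e}"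
        "card E1 \<le> card E' + sum t (active E1)"
        using less.hyps by blast
      have "E = E1 \<union> {e \<in> E. S i \<subseteq> e}" unfolding E1_def by auto
      then have "card E = card (E1 \<union> {e \<in> E. S i \<subseteq> e})" by simp
      also have "\<dots> = card E1 + card {e \<in> E. S i \<subseteq> e}"
        using less.prems \<open>finite E1\<close> by (intro card_Un_disjoint) (auto simp: E1_def)
      also have "\<dots> \<le> card E' + (sum t (active E1) + t i)" using E'(3) i(4) by simp
      also have "sum t (active E1) + t i \<le> sum t (active E)"
      proof -
        have "finite (active E)" using \<open>finite I\<close> unfolding active_def by simp
        moreover have "active E1 \<subseteq> active E - {i}" unfolding active_def E1_def by auto
        ultimately have "sum t (active E1) \<le> sum t (active E - {i})"
          by (intro sum_mono2) auto
        moreover have "i \<in> active E" using i unfolding active_def by auto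
        ultimately show ?thesis
          using \<open>finite (active E)\<close> by (simp add: sum.remove)
      qed
      finally have "card E \<le> card E' + sum t (active E)" by simp
      then show ?thesis using E'(1,2) \<open>E1 \<subset> E\<close> by blast
    qed
  qed
  then obtain E' where E': "E' \<subseteq> E"
    "\<forall>i \<in> I. \<forall>e \<in> E'. S i \<subseteq> e \<longrightarrow> t i \<le> card {e \<in> E'. S i \<subseteq> e}"
    "card E \<le> card E' + sum t (active E)" by blast
  moreover have "sum t (active E) \<le> sum t I"
    using \<open>finite I\<close> unfolding active_def by (intro sum_mono2) auto
  ultimately show thesis using that[of E'] by fastforce
qed

lemma card_nbhd_pair:
  assumes "\<And>e. e \<in> E \<Longrightarrow> card e = 3" and "a \<noteq> b"
  shows "card (nbhd E {a, b}) = card {e \<in> E. {a, b} \<subseteq> e}"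
proof (rule bij_betw_same_card[of "\<lambda>y. insert y {a, b}"], unfold bij_betw_def, intro conjI)
  show "inj_on (\<lambda>y. insert y {a, b}) (nbhd E {a, b})"
    by (auto simp: inj_on_def nbhd_def)
  show "(\<lambda>y. insert y {a, b}) ` nbhd E {a, b} = {e \<in> E. {a, b} \<subseteq> e}"
  proof (intro equalityI subsetI)
    fix e assume e: "e \<in> {e \<in> E. {a, b} \<subseteq> e}"
    then have "card (e - {a, b}) = 1"
      using assms by (subst card_Diff_subset) auto
    then obtain y where "e - {a, b} = {y}" by (auto simp: card_1_singleton_iff)
    then have "e = insert y {a, b}" "y \<notin> {a, b}" using e by auto
    with e show "e \<in> (\<lambda>y. insert y {a, b}) ` nbhd E {a, b}"
      unfolding nbhd_def by auto
  qed (auto simp: nbhd_def)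
qed

text \<open>
  The number \<open>8\<close> is what the embeddings below need: the last triple of a copy of \<open>F1\<close> has to
  avoid the seven other vertices of the copy.
\<close>

locale full_triples =
  fixes V :: "'a set" and E :: "'a set set"
  assumes triple_system: "triple_system (V, E)"
    and codegree: "\<And>e a b. e \<in> E \<Longrightarrow> a \<in> e \<Longrightarrow> b \<in> e \<Longrightarrow> a \<noteq> b \<Longrightarrow> 8 \<le> card (nbhd E {a, b})"
begin

lemma finite_V: "finite V" and sub_V: "e \<in> E \<Longrightarrow> e \<subseteq> V" and card3: "e \<in> E \<Longrightarrow> card e = 3"
  using triple_system unfolding triple_system_def by auto

lemma finite_E: "finite E"
  using sub_V finite_V by (meson Pow_iff finite_Pow_iff finite_subset subsetI)

lemma nbhd_sub: "nbhd E P \<subseteq> V"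
  using sub_V unfolding nbhd_def by auto

lemma finite_nbhd: "finite (nbhd E P)"
  using nbhd_sub finite_V finite_subset by blast

lemma tripleE:
  assumes "e \<in> E" "a \<in> e"
  obtains b c where "e = {a, b, c}" "a \<noteq> b" "a \<noteq> c" "b \<noteq> c"
proof -
  have "card (e - {a}) = 2" using card3[OF assms(1)] assms(2) by simp
  then obtain b c where "e - {a} = {b, c}" "b \<noteq> c" by (auto simp: card_2_iff)
  then show thesis using that[of b c] assms(2) by blast
qed

lemma new_vertex:
  assumes "e \<in> E" "p \<in> e" "q \<in> e" "p \<noteq> q" "length xs \<le> 7"
  obtains w where "w \<notin> set xs" "w \<noteq> p" "w \<noteq> q" "{w, p, q} \<in> E"
proof -
  have "card (set xs) < card (nbhd E {p, q})"
    using codegree[OF assms(1-4)] card_length[of xs] assms(5) by linarith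
  then have "\<not> nbhd E {p, q} \<subseteq> set xs"
    by (metis List.finite_set card_mono not_le)
  then show thesis using that unfolding nbhd_def by blast
qed

end

text \<open>
  Pairs and vertices are cleaned together, as a deletion for one kind can spoil the other: the
  index \<open>(a, b)\<close> stands for the set \<open>{a, b}\<close>, which is a single vertex on the diagonal.
\<close>

lemma full_subsystem:
  assumes "triple_system (V, E)"
  obtains E' where "E' \<subseteq> E" "full_triples V E'"
    "\<And>e a. e \<in> E' \<Longrightarrow> a \<in> e \<Longrightarrow> 2 * card V < card {e \<in> E'. a \<in> e}"
    "card E \<le> card E' + 10 * card V ^ 2"
proof -
  have V: "finite V" and E: "\<And>e. e \<in> E \<Longrightarrow> e \<subseteq> V" "\<And>e. e \<in> E \<Longrightarrow> card e = 3"
    using assms unfolding triple_system_def by auto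
  have "finite E" using V E(1) by (meson Pow_iff finite_Pow_iff finite_subset subsetI)
  define t :: "'a \<times> 'a \<Rightarrow> nat" where "t = (\<lambda>(a, b). if a = b then 2 * card V + 1 else 8)"
  obtain E' where E': "E' \<subseteq> E"
    "\<And>i e. i \<in> V \<times> V \<Longrightarrow> e \<in> E' \<Longrightarrow> {fst i, snd i} \<subseteq> e \<Longrightarrow> t i \<le> card {e \<in> E'. {fst i, snd i} \<subseteq> e}"
    "card E \<le> card E' + sum t (V \<times> V)"
    using cleaning[of "V \<times> V" E "\<lambda>i. {fst i, snd i}" t] V \<open>finite E\<close> by auto
  have "sum t (V \<times> V) = (\<Sum>a\<in>V. \<Sum>b\<in>V. t (a, b))"
    by (simp add: sum.cartesian_product)
  also have "\<dots> = (\<Sum>a\<in>V. 2 * card V + 1 + 8 * (card V - 1))"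
  proof (intro sum.cong refl)
    fix a assume "a \<in> V"
    then have "(\<Sum>b\<in>V. t (a, b)) = t (a, a) + (\<Sum>b\<in>V-{a}. t (a, b))"
      using V by (simp add: sum.remove)
    also have "(\<Sum>b\<in>V-{a}. t (a, b)) = (\<Sum>b\<in>V-{a}. 8)"
      by (intro sum.cong) (auto simp: t_def)
    finally show "(\<Sum>b\<in>V. t (a, b)) = 2 * card V + 1 + 8 * (card V - 1)"
      using V \<open>a \<in> V\<close> by (simp add: t_def)
  qed
  also have "\<dots> = card V * (2 * card V + 1 + 8 * (card V - 1))" by simp
  also have "\<dots> \<le> card V * (10 * card V)" by (cases "card V") (auto simp: algebra_simps)
  finally have "card E \<le> card E' + 10 * card V ^ 2"
    using E'(3) by (simp add: power2_eq_square)
  moreover have "full_triples V E'"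
  proof
    show "triple_system (V, E')" using V E E'(1) unfolding triple_system_def by auto
    fix e a b assume e: "e \<in> E'" "a \<in> e" "b \<in> e" "a \<noteq> b"
    then have "8 \<le> card {e \<in> E'. {a, b} \<subseteq> e}"
      using E'(2)[of "(a, b)" e] E(1)[of e] E'(1) by (auto simp: t_def)
    then show "8 \<le> card (nbhd E' {a, b})"
      using E(2) E'(1) e(4) by (subst card_nbhd_pair) auto
  qed
  moreover have "2 * card V < card {e \<in> E'. a \<in> e}" if "e \<in> E'" "a \<in> e" for e a
  proof -
    have "a \<in> V" using E(1) E'(1) that by blast
    then show ?thesis using E'(2)[of "(a, a)" e] that by (simp add: t_def)
  qed
  ultimately show thesis using that E'(1) by blast
qed

section \<open>Embedding special four cycles\<close>

lemma contains_copy_mono: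
  "contains_copy (V, E') H \<Longrightarrow> E' \<subseteq> E \<Longrightarrow> contains_copy (V, E) H"
  unfolding contains_copy_def by (metis fst_conv snd_conv subsetD)

text \<open>
  The vertices of the cycles \<open>F1\<close> to \<open>F7\<close> are numbered from \<open>1\<close>, hence the shift of the list
  index.
\<close>

lemma contains_special_four_cycle:
  assumes G: "triple_system (V, E)" and xs: "distinct xs" "\<And>i. f i = xs ! (i - 1)"
    and dom: "{v1, v2, v3, v4, w1, w2, w3, w4} \<subseteq> {1..length xs}"
    and edges: "{f w1, f v1, f v2} \<in> E" "{f w2, f v2, f v3} \<in> E"
      "{f w3, f v3, f v4} \<in> E" "{f w4, f v4, f v1} \<in> E"
  shows "contains_copy (V, E) (special_four_cycle v1 v2 v3 v4 w1 w2 w3 w4)"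
proof -
  have "inj_on f {v1, v2, v3, v4, w1, w2, w3, w4}"
  proof (rule inj_on_subset[OF _ dom], rule inj_onI)
    fix i j assume "i \<in> {1..length xs}" "j \<in> {1..length xs}" "f i = f j"
    then have "i - 1 = j - 1" "1 \<le> i" "1 \<le> j"
      using xs by (auto simp: nth_eq_iff_index_eq)
    then show "i = j" by linarith
  qed
  moreover have "\<Union> E \<subseteq> V" using G unfolding triple_system_def by auto
  then have "f ` {v1, v2, v3, v4, w1, w2, w3, w4} \<subseteq> V" using edges by auto
  ultimately show ?thesis
    unfolding contains_copy_def special_four_cycle_def
    using edges by (intro exI[of _ f]) (simp add: insert_commute Un_insert_right)
qed

lemma contains_F1:
  assumes "triple_system (V, E)" "distinct [v1, v2, v3, v4, w1, w2, w3, w4]"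
    "{w1, v1, v2} \<in> E" "{w2, v2, v3} \<in> E" "{w3, v3, v4} \<in> E" "{w4, v4, v1} \<in> E"
  shows "contains_copy (V, E) F1"
  unfolding F1_def
  by (rule contains_special_four_cycle[OF assms(1,2) refl]) (use assms(3-) in simp_all)

lemma contains_F3:
  assumes "triple_system (V, E)" "distinct [v1, v2, v3, v4, w1, w3]"
    "{w1, v1, v2} \<in> E" "{w1, v2, v3} \<in> E" "{w3, v3, v4} \<in> E" "{w3, v4, v1} \<in> E"
  shows "contains_copy (V, E) F3"
  unfolding F3_def
  by (rule contains_special_four_cycle[OF assms(1,2) refl]) (use assms(3-) in simp_all)

lemma contains_F7:
  assumes "triple_system (V, E)" "distinct [v1, v2, v3, v4, w1, w3, w4]"
    "{w1, v1, v2} \<in> E" "{w1, v2, v3} \<in> E" "{w3, v3, v4} \<in> E" "{w4, v4, v1} \<in> E"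
  shows "contains_copy (V, E) F7"
  unfolding F7_def
  by (rule contains_special_four_cycle[OF assms(1,2) refl]) (use assms(3-) in simp_all)

section \<open>Full systems without \<open>F1\<close> or \<open>F7\<close>\<close>

context full_triples
begin

text \<open>
  For two triples \<open>abc\<close> and \<open>abd\<close> the pairs \<open>ac\<close>, \<open>cb\<close>, \<open>bd\<close>, \<open>da\<close> form a four cycle, which is
  extended greedily.
\<close>

lemma F1_free_empty:
  assumes "\<not> contains_copy (V, E) F1"
  shows "E = {}"
proof (rule ccontr)
  assume "E \<noteq> {}"
  then obtain e where e: "e \<in> E" by blast
  then have "e \<noteq> {}" using card3 by fastforce
  then obtain a b c where abc: "e = {a, b, c}" "a \<noteq> b" "a \<noteq> c" "b \<noteq> c"
    using tripleE[OF e] by (metis all_not_in_conv)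
  obtain d where d: "d \<notin> set [c]" "d \<noteq> a" "d \<noteq> b" "{d, a, b} \<in> E"
    using new_vertex[OF e, of a b "[c]"] abc by auto
  obtain w1 where w1: "w1 \<notin> set [a, b, c, d]" "{w1, a, c} \<in> E"
    using new_vertex[OF e, of a c "[a, b, c, d]"] abc by auto
  obtain w2 where w2: "w2 \<notin> set [a, b, c, d, w1]" "{w2, c, b} \<in> E"
    using new_vertex[OF e, of c b "[a, b, c, d, w1]"] abc by auto
  obtain w3 where w3: "w3 \<notin> set [a, b, c, d, w1, w2]" "{w3, b, d} \<in> E"
    using new_vertex[OF d(4), of b d "[a, b, c, d, w1, w2]"] d by auto
  obtain w4 where w4: "w4 \<notin> set [a, b, c, d, w1, w2, w3]" "{w4, d, a} \<in> E"
    using new_vertex[OF d(4), of d a "[a, b, c, d, w1, w2, w3]"] d by auto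
  have "contains_copy (V, E) F1"
    using abc d w1 w2 w3 w4
    by (intro contains_F1[OF triple_system, of a c b d w1 w2 w3 w4]) auto
  with assms show False by blast
qed

definition shadow :: "'a \<Rightarrow> 'a set" where
  "shadow x = {z. z \<noteq> x \<and> (\<exists>e \<in> E. x \<in> e \<and> z \<in> e)}"

lemma shadow_sub: "shadow x \<subseteq> V"
  using sub_V unfolding shadow_def by auto

text \<open>
  A common element \<open>z\<close> closes the four cycle \<open>x\<close>, \<open>b\<close>, \<open>y\<close>, \<open>z\<close>: its first two edges lie in
  triples with the same third vertex \<open>a\<close>, and the other two extend to new vertices.
\<close>

lemma F7_free_disjoint_shadows:
  assumes free: "\<not> contains_copy (V, E) F7"
    and xy: "x \<in> nbhd E {a, b}" "y \<in> nbhd E {a, b}" "x \<noteq> y" and "a \<noteq> b"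
  shows "(shadow x - {a, b}) \<inter> (shadow y - {a, b}) = {}"
proof (rule ccontr)
  assume "(shadow x - {a, b}) \<inter> (shadow y - {a, b}) \<noteq> {}"
  then obtain z e e' where z: "z \<noteq> a" "z \<noteq> b" "z \<noteq> x" "z \<noteq> y"
    "e \<in> E" "x \<in> e" "z \<in> e" "e' \<in> E" "y \<in> e'" "z \<in> e'"
    unfolding shadow_def by auto
  obtain w3 where w3: "w3 \<notin> set [a, b, x, y, z]" "{w3, y, z} \<in> E"
    using new_vertex[OF z(8-10), of "[a, b, x, y, z]"] z by auto
  obtain w4 where w4: "w4 \<notin> set [a, b, x, y, z, w3]" "{w4, z, x} \<in> E"
    using new_vertex[OF z(5) z(7) z(6), of "[a, b, x, y, z, w3]"] z by auto
  have "contains_copy (V, E) F7"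
    using xy z w3 w4 \<open>a \<noteq> b\<close> unfolding nbhd_def
    by (intro contains_F7[OF triple_system, of x b y z a w3 w4]) (auto simp: insert_commute)
  with free show False by blast
qed

text \<open>
  Let \<open>b\<close> have the smallest shadow, of size \<open>m\<close>. For \<open>a\<close> in it, the disjoint sets of
  \<open>F7_free_disjoint_shadows\<close> have at least \<open>m - 2 \<ge> m / 2\<close> elements each, so there are at
  most \<open>2n / m\<close> of them. Summing this codegree over the \<open>m\<close> choices of \<open>a\<close> bounds the degree
  of \<open>b\<close> by \<open>2n\<close>.
\<close>

lemma F7_free_empty:
  assumes free: "\<not> contains_copy (V, E) F7"
    and degree: "\<And>e a. e \<in> E \<Longrightarrow> a \<in> e \<Longrightarrow> 2 * card V < card {e \<in> E. a \<in> e}"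
  shows "E = {}"
proof (rule ccontr)
  assume "E \<noteq> {}"
  then have "\<Union> E \<noteq> {}" using card3 by fastforce
  moreover have "finite (\<Union> E)" using sub_V finite_V by (meson Sup_least finite_subset)
  ultimately obtain b where b: "b \<in> \<Union> E"
    and b_min: "\<And>x. x \<in> \<Union> E \<Longrightarrow> card (shadow b) \<le> card (shadow x)"
    using ex_is_arg_min_if_finite[of "\<Union> E" "\<lambda>x. card (shadow x)"]
    by (auto simp: is_arg_min_linorder)
  define m where "m = card (shadow b)"
  have fin: "finite (shadow x)" for x using shadow_sub finite_V finite_subset by blast
  have pair: "m * card (nbhd E {a, b}) \<le> 2 * card V" if a: "a \<in> shadow b" for a
  proof -
    obtain e where e: "e \<in> E" "a \<in> e" "b \<in> e" "a \<noteq> b" using a unfolding shadow_def by auto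
    have "nbhd E {a, b} \<subseteq> shadow b"
    proof
      fix y assume "y \<in> nbhd E {a, b}"
      then have "insert y {a, b} \<in> E" "y \<noteq> b" unfolding nbhd_def by simp_all
      then show "y \<in> shadow b"
        unfolding shadow_def by (intro CollectI conjI bexI[of _ "insert y {a, b}"]) simp_all
    qed
    then have "8 \<le> m" using codegree[OF e] card_mono[OF fin, of _ b] unfolding m_def by (meson order_trans)
    have "(\<Sum>x \<in> nbhd E {a, b}. m - 2) \<le> (\<Sum>x \<in> nbhd E {a, b}. card (shadow x - {a, b}))"
    proof (rule sum_mono)
      fix x assume "x \<in> nbhd E {a, b}"
      then have "insert x {a, b} \<in> E" unfolding nbhd_def by simp
      then have "x \<in> \<Union> E" by blast
      then have "m \<le> card (shadow x)" using b_min unfolding m_def by blast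
      moreover have "card (shadow x) - card {a, b} \<le> card (shadow x - {a, b})"
        by (rule diff_card_le_card_Diff) simp
      ultimately show "m - 2 \<le> card (shadow x - {a, b})" using e(4) by simp
    qed
    also have "\<dots> = card (\<Union>x \<in> nbhd E {a, b}. shadow x - {a, b})"
      using F7_free_disjoint_shadows[OF free] e(4) fin finite_nbhd
      by (intro card_UN_disjoint[symmetric]) auto
    also have "\<dots> \<le> card V" using shadow_sub by (intro card_mono finite_V) blast
    finally have "card (nbhd E {a, b}) * (m - 2) \<le> card V" by simp
    moreover have "m * card (nbhd E {a, b}) \<le> 2 * (m - 2) * card (nbhd E {a, b})"
      using \<open>8 \<le> m\<close> by (intro mult_le_mono1) simp
    ultimately show ?thesis by (simp only: mult.assoc mult.commute[of _ "m - 2"])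
  qed
  \<comment> \<open>Each triple through \<open>b\<close> is counted twice on the right; the union bound is enough.\<close>
  have "{e \<in> E. b \<in> e} \<subseteq> (\<Union>a \<in> shadow b. {e \<in> E. {a, b} \<subseteq> e})"
  proof
    fix e assume e: "e \<in> {e \<in> E. b \<in> e}"
    then obtain a c where "e = {b, a, c}" "b \<noteq> a" using tripleE by (metis mem_Collect_eq)
    then have a: "a \<in> e" "a \<noteq> b" by simp_all
    then have "a \<in> shadow b" using e unfolding shadow_def by blast
    then show "e \<in> (\<Union>a \<in> shadow b. {e \<in> E. {a, b} \<subseteq> e})" using a e by blast
  qed
  then have "card {e \<in> E. b \<in> e} \<le> card (\<Union>a \<in> shadow b. {e \<in> E. {a, b} \<subseteq> e})"
    using fin finite_E by (intro card_mono) auto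
  also have "\<dots> \<le> (\<Sum>a \<in> shadow b. card {e \<in> E. {a, b} \<subseteq> e})"
    by (rule card_UN_le[OF fin])
  also have "\<dots> = (\<Sum>a \<in> shadow b. card (nbhd E {a, b}))"
    using card3 by (intro sum.cong card_nbhd_pair[symmetric]) (auto simp: shadow_def)
  finally have "m * card {e \<in> E. b \<in> e} \<le> (\<Sum>a \<in> shadow b. m * card (nbhd E {a, b}))"
    by (simp add: sum_distrib_left[symmetric])
  also have "\<dots> \<le> (\<Sum>a \<in> shadow b. 2 * card V)" by (rule sum_mono) (rule pair)
  also have "\<dots> = m * (2 * card V)" by (simp add: m_def)
  finally have "m = 0 \<or> card {e \<in> E. b \<in> e} \<le> 2 * card V" by auto
  moreover obtain e where e: "e \<in> E" "b \<in> e" using b by blast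
  moreover have "m \<noteq> 0"
  proof -
    obtain a c where "e = {b, a, c}" "b \<noteq> a" using e tripleE by metis
    then have "a \<in> e" "a \<noteq> b" by simp_all
    then have "a \<in> shadow b" using e unfolding shadow_def by blast
    then show ?thesis unfolding m_def using fin by auto
  qed
  ultimately show False using degree[OF e] by linarith
qed

end

section \<open>Full systems without \<open>F3\<close>\<close>

text \<open>
  A pair \<open>Q\<close> that misses \<open>a\<close> and a pair \<open>R\<close> that misses \<open>b\<close> must be \<open>bc\<close> and \<open>ac\<close> for the same
  \<open>c\<close>, and no fourth pair meets all edges of this triangle.
\<close>

lemma intersecting_pairs:
  assumes two: "\<And>Q. Q \<in> I \<Longrightarrow> card Q = 2"
    and meet: "\<And>Q R. Q \<in> I \<Longrightarrow> R \<in> I \<Longrightarrow> Q \<inter> R \<noteq> {}"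
    and ab: "{a, b} \<in> I"
  shows "(\<forall>Q \<in> I. a \<in> Q) \<or> (\<forall>Q \<in> I. b \<in> Q) \<or> card I \<le> 3"
proof (rule ccontr)
  assume neg: "\<not> ?thesis"
  then obtain Q R where Q: "Q \<in> I" "a \<notin> Q" and R: "R \<in> I" "b \<notin> R" by blast
  have "a \<noteq> b" using two[OF ab] by auto
  have "b \<in> Q" "a \<in> R" using meet[OF ab Q(1)] meet[OF ab R(1)] Q R by auto
  then obtain c d where c: "Q = {b, c}" "b \<noteq> c" and d: "R = {a, d}"
    using two[OF Q(1)] two[OF R(1)] by (auto simp: card_2_iff)
  have "c = d" using meet[OF Q(1) R(1)] c d Q R by auto
  have "a \<noteq> c" using Q(2) c by simp
  have "I \<subseteq> {{a, b}, {b, c}, {a, c}}"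
  proof
    fix S assume S: "S \<in> I"
    obtain s t where st: "S = {s, t}" "s \<noteq> t" using two[OF S] by (auto simp: card_2_iff)
    have "s = a \<or> s = b \<or> t = a \<or> t = b" using meet[OF S ab] st(1) by simp blast
    moreover have "s = b \<or> s = c \<or> t = b \<or> t = c" using meet[OF S Q(1)] st(1) c(1) by simp blast
    moreover have "s = a \<or> s = c \<or> t = a \<or> t = c"
      using meet[OF S R(1)] st(1) d \<open>c = d\<close> by simp blast
    ultimately show "S \<in> {{a, b}, {b, c}, {a, c}}"
      unfolding st(1) insert_iff doubleton_eq_iff
      using st(2) \<open>a \<noteq> b\<close> c(2) \<open>a \<noteq> c\<close> by metis
  qed
  then have "card I \<le> card {{a, b}, {b, c}, {a, c}}" by (rule card_mono[rotated]) simp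
  also have "\<dots> \<le> 3" by (simp add: card_insert_if)
  finally show False using neg by blast
qed

context full_triples
begin

lemma link_pair: "P \<in> link E x \<Longrightarrow> card P = 2"
proof -
  assume "P \<in> link E x"
  then have P: "x \<notin> P" "insert x P \<in> E" unfolding link_def by auto
  then have "finite P" using sub_V finite_V by (meson finite_insert finite_subset)
  then show ?thesis using P card3[OF P(2)] by simp
qed

lemma finite_link: "finite (link E x)"
proof -
  have "link E x \<subseteq> Pow V" using sub_V unfolding link_def by auto
  then show ?thesis using finite_V by (meson finite_Pow_iff finite_subset)
qed

text \<open>
  Disjoint pairs \<open>ab\<close> and \<open>cd\<close> in both links give the four cycle \<open>x\<close>, \<open>b\<close>, \<open>y\<close>, \<open>d\<close> with third
  vertices \<open>a\<close>, \<open>a\<close>, \<open>c\<close>, \<open>c\<close>.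
\<close>

lemma F3_free_meet:
  assumes free: "\<not> contains_copy (V, E) F3" and "x \<noteq> y"
    and Q: "Q \<in> link E x \<inter> link E y" and R: "R \<in> link E x \<inter> link E y"
  shows "Q \<inter> R \<noteq> {}"
proof
  assume disj: "Q \<inter> R = {}"
  obtain a b c d where *: "Q = {a, b}" "a \<noteq> b" "R = {c, d}" "c \<noteq> d"
    using link_pair Q R by (metis IntD1 card_2_iff)
  have "contains_copy (V, E) F3"
    using * disj Q R \<open>x \<noteq> y\<close> unfolding link_def
    by (intro contains_F3[OF triple_system, of x b y d a c]) (auto simp: insert_commute)
  with free show False by blast
qed

lemma star_in_link:
  assumes "\<forall>Q \<in> I. a \<in> Q" "I \<subseteq> link E x"
  shows "card I \<le> card (nbhd E {a, x})"
proof -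
  have "I \<subseteq> (\<lambda>z. {a, z}) ` nbhd E {a, x}"
  proof
    fix Q assume Q: "Q \<in> I"
    then have "card Q = 2" "a \<in> Q" using link_pair assms by auto
    then obtain z where "Q = {a, z}" "a \<noteq> z"
      unfolding card_2_iff by blast
    moreover have "{a, z} \<in> link E x" using Q assms(2) \<open>Q = {a, z}\<close> by blast
    then have "z \<in> nbhd E {a, x}"
      using \<open>a \<noteq> z\<close> unfolding link_def nbhd_def by (auto simp: insert_commute)
    ultimately show "Q \<in> (\<lambda>z. {a, z}) ` nbhd E {a, x}" by blast
  qed
  then show ?thesis using finite_nbhd by (rule surj_card_le[rotated])
qed

lemma F3_free_common_link:
  assumes free: "\<not> contains_copy (V, E) F3" and "x \<noteq> y"
    and ab: "{a, b} \<in> link E x \<inter> link E y"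
    and "card (nbhd E {a, x}) \<le> d" "card (nbhd E {b, x}) \<le> d" "3 \<le> d"
  shows "card (link E x \<inter> link E y) \<le> d"
proof -
  let ?I = "link E x \<inter> link E y"
  have "(\<forall>Q \<in> ?I. a \<in> Q) \<or> (\<forall>Q \<in> ?I. b \<in> Q) \<or> card ?I \<le> 3"
    using link_pair F3_free_meet[OF free \<open>x \<noteq> y\<close>] ab by (intro intersecting_pairs) blast+
  then consider "\<forall>Q \<in> ?I. a \<in> Q" | "\<forall>Q \<in> ?I. b \<in> Q" | "card ?I \<le> 3" by blast
  then show ?thesis
  proof cases
    case 1
    from star_in_link[OF 1 Int_lower1] show ?thesis using assms(4) by linarith
  next
    case 2
    from star_in_link[OF 2 Int_lower1] show ?thesis using assms(5) by linarith
  qed (use assms(6) in linarith)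
qed

lemma heaviest_pair:
  assumes "e \<in> E"
  obtains a b x where "e = {a, b, x}" "a \<noteq> b" "x \<notin> {a, b}"
    "card (nbhd E {a, x}) \<le> card (nbhd E {a, b})" "card (nbhd E {b, x}) \<le> card (nbhd E {a, b})"
proof -
  have "e \<noteq> {}" using card3[OF assms] by auto
  then obtain p q r where e: "e = {p, q, r}" "p \<noteq> q" "p \<noteq> r" "q \<noteq> r"
    using tripleE[OF assms] by (metis all_not_in_conv)
  let ?c = "\<lambda>p q. card (nbhd E {p, q})"
  consider "?c p q \<ge> ?c p r" "?c p q \<ge> ?c q r" | "?c p r \<ge> ?c p q" "?c p r \<ge> ?c q r"
    | "?c q r \<ge> ?c p q" "?c q r \<ge> ?c p r" by linarith
  then show thesis
  proof cases
    case 1 then show ?thesis using that[of p q r] e by auto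
  next
    case 2 then show ?thesis using that[of p r q] e by (auto simp: insert_commute)
  next
    case 3 then show ?thesis using that[of q r p] e by (auto simp: insert_commute)
  qed
qed

text \<open>
  A dominant pair \<open>P\<close> of a triple is one whose codegree also bounds the common link of the
  remaining vertex \<open>x\<close> with every other extension of \<open>P\<close>. This makes the weight of the triple,
  counted from \<open>P\<close>, bounded below.
\<close>

definition dominant :: "'a set \<Rightarrow> 'a \<Rightarrow> 'a set \<Rightarrow> bool" where
  "dominant e x P \<longleftrightarrow> insert x P = e \<and> x \<notin> P \<and> 8 \<le> card (nbhd E P) \<and>
     (\<forall>y \<in> nbhd E P - {x}. card (link E x \<inter> link E y) \<le> card (nbhd E P))"

lemma F3_free_dominant:
  assumes free: "\<not> contains_copy (V, E) F3" and e: "e \<in> E"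
  shows "\<exists>x P. dominant e x P"
proof -
  obtain a b x where abx: "e = {a, b, x}" "a \<noteq> b" "x \<notin> {a, b}"
    "card (nbhd E {a, x}) \<le> card (nbhd E {a, b})" "card (nbhd E {b, x}) \<le> card (nbhd E {a, b})"
    using heaviest_pair[OF e] .
  have ins: "insert x {a, b} = e" using abx(1) by auto
  have 8: "8 \<le> card (nbhd E {a, b})" using codegree[OF e, of a b] abx(1,2) by simp
  have "card (link E x \<inter> link E y) \<le> card (nbhd E {a, b})" if y: "y \<in> nbhd E {a, b} - {x}" for y
  proof (rule F3_free_common_link[OF free _ _ abx(4,5)])
    show "{a, b} \<in> link E x \<inter> link E y"
      using ins abx(3) e y unfolding link_def nbhd_def by simp
    show "x \<noteq> y" using y by blast
    show "3 \<le> card (nbhd E {a, b})" using 8 by linarith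
  qed
  then have "dominant e x {a, b}" unfolding dominant_def using ins abx(3) 8 by blast
  then show ?thesis by blast
qed

text \<open>
  Double counting of the pairs \<open>k = (e, y)\<close>, where \<open>y\<close> is a further extension of the dominant
  pair \<open>P e\<close> of the triple \<open>e\<close>, with the weight \<open>h (X e, y)\<close>. Each \<open>e\<close> collects at least
  \<open>7/8\<close>, of which \<open>1/2\<close> is used. For fixed \<open>(x, y)\<close> the triples with \<open>X e = x\<close> are determined by
  \<open>P e\<close>, which lies in the common link of \<open>x\<close> and \<open>y\<close>, so their weights add up to at most \<open>1\<close>.
\<close>

lemma F3_free_bound:
  assumes free: "\<not> contains_copy (V, E) F3"
  shows "card E \<le> 2 * card V ^ 2"
proof -
  obtain X P where dom: "\<And>e. e \<in> E \<Longrightarrow> dominant e (X e) (P e)"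
    using F3_free_dominant[OF free] by metis
  then have XP: "\<And>e. e \<in> E \<Longrightarrow> insert (X e) (P e) = e" "\<And>e. e \<in> E \<Longrightarrow> X e \<notin> P e"
    "\<And>e. e \<in> E \<Longrightarrow> 8 \<le> card (nbhd E (P e))"
    "\<And>e y. e \<in> E \<Longrightarrow> y \<in> nbhd E (P e) - {X e} \<Longrightarrow>
      card (link E (X e) \<inter> link E y) \<le> card (nbhd E (P e))"
    unfolding dominant_def by blast+
  define K where "K = (SIGMA e : E. nbhd E (P e) - {X e})"
  define g where "g k = (X (fst k), snd k)" for k :: "'a set \<times> 'a"
  define h :: "'a \<times> 'a \<Rightarrow> real" where "h = (\<lambda>(x, y). 1 / card (link E x \<inter> link E y))"
  have K: "fst k \<in> E" "snd k \<in> nbhd E (P (fst k))" if "k \<in> K" for k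
    using that unfolding K_def by (cases k, simp)+
  have "finite K" unfolding K_def using finite_E finite_nbhd by (intro finite_SigmaI) auto
  have "real (card E) / 2 = (\<Sum>e \<in> E. 1 / 2)" by simp
  also have "\<dots> \<le> (\<Sum>e \<in> E. \<Sum>y \<in> nbhd E (P e) - {X e}. h (X e, y))"
  proof (rule sum_mono)
    fix e assume e: "e \<in> E"
    let ?N = "nbhd E (P e)"
    have X: "X e \<in> ?N" using XP(1,2)[OF e] e unfolding nbhd_def by simp
    have "1 / 2 \<le> real (card ?N - 1) / card ?N" using XP(3)[OF e] by (simp add: field_simps)
    also have "\<dots> = (\<Sum>y \<in> ?N - {X e}. 1 / card ?N)" using X finite_nbhd by simp
    also have "\<dots> \<le> (\<Sum>y \<in> ?N - {X e}. h (X e, y))"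
    proof (rule sum_mono)
      fix y assume y: "y \<in> ?N - {X e}"
      have "P e \<in> link E (X e) \<inter> link E y"
        using y X unfolding nbhd_def link_def by simp
      then have "0 < card (link E (X e) \<inter> link E y)" using finite_link by (auto simp: card_gt_0_iff)
      then show "1 / card ?N \<le> h (X e, y)"
        using XP(4)[OF e y] unfolding h_def by (simp add: frac_le)
    qed
    finally show "1 / 2 \<le> (\<Sum>y \<in> ?N - {X e}. h (X e, y))" .
  qed
  also have "\<dots> = (\<Sum>k \<in> K. h (g k))"
    unfolding K_def g_def using finite_E finite_nbhd
    by (simp add: sum.Sigma case_prod_unfold)
  also have "\<dots> = (\<Sum>p \<in> V \<times> V. \<Sum>k \<in> {k \<in> K. g k = p}. h (g k))"
  proof (rule sum.group[symmetric])
    show "g ` K \<subseteq> V \<times> V"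
    proof
      fix p assume "p \<in> g ` K"
      then obtain k where k: "k \<in> K" "p = g k" by blast
      have "X (fst k) \<in> V" using XP(1)[OF K(1)[OF k(1)]] sub_V[OF K(1)[OF k(1)]] by blast
      then show "p \<in> V \<times> V" using k K(2)[OF k(1)] nbhd_sub unfolding g_def by blast
    qed
  qed (use \<open>finite K\<close> finite_V in auto)
  also have "\<dots> \<le> (\<Sum>p \<in> V \<times> V. 1)"
  proof (rule sum_mono)
    fix p :: "'a \<times> 'a"
    obtain x y where p: "p = (x, y)" by force
    let ?F = "{k \<in> K. g k = p}" and ?I = "link E x \<inter> link E y"
    have "card ?F \<le> card ?I"
    proof (rule card_inj_on_le[of "\<lambda>k. P (fst k)"])
      show "inj_on (\<lambda>k. P (fst k)) ?F"
      proof (rule inj_onI)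
        fix k k' assume *: "k \<in> ?F" "k' \<in> ?F" "P (fst k) = P (fst k')"
        then have g: "X (fst k) = X (fst k')" "snd k = snd k'" and "k \<in> K" "k' \<in> K"
          unfolding g_def p by simp_all
        have "fst k = insert (X (fst k)) (P (fst k))" using XP(1) K(1) \<open>k \<in> K\<close> by simp
        also have "\<dots> = insert (X (fst k')) (P (fst k'))" by (simp only: g *(3))
        also have "\<dots> = fst k'" using XP(1) K(1) \<open>k' \<in> K\<close> by simp
        finally have "fst k = fst k'" .
        then show "k = k'" using g(2) by (rule prod_eqI)
      qed
      show "(\<lambda>k. P (fst k)) ` ?F \<subseteq> ?I"
      proof
        fix Q assume "Q \<in> (\<lambda>k. P (fst k)) ` ?F"
        then obtain k where k: "k \<in> K" "g k = (x, y)" "Q = P (fst k)" using p by blast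
        then have "X (fst k) = x" "snd k = y" unfolding g_def by simp_all
        then show "Q \<in> ?I"
          using k(3) K[OF k(1)] XP(1,2)[OF K(1)[OF k(1)]] unfolding link_def nbhd_def by simp
      qed
      show "finite ?I" using finite_link by blast
    qed
    have "(\<Sum>k \<in> ?F. h (g k)) = (\<Sum>k \<in> ?F. h p)" by (rule sum.cong) auto
    also have "\<dots> = card ?F / card ?I" unfolding h_def p by simp
    also have "\<dots> \<le> 1" using \<open>card ?F \<le> card ?I\<close> by (auto simp: divide_le_eq_1)
    finally show "(\<Sum>k \<in> ?F. h (g k)) \<le> 1" .
  qed
  also have "\<dots> = real (card V) ^ 2" by (simp add: card_cartesian_product power2_eq_square)
  finally have "real (card E) \<le> real (2 * card V ^ 2)" by simp
  then show ?thesis by (simp only: of_nat_le_iff)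
qed

end

section \<open>The order of magnitude\<close>

lemma upper_bound:
  assumes G: "triple_system G" and H: "H \<in> {F1, F3, F7}" and free: "\<not> contains_copy G H"
  shows "card (triples G) \<le> 12 * card (verts G) ^ 2"
proof -
  obtain V E where VE: "G = (V, E)" by force
  obtain E' where E': "E' \<subseteq> E" "full_triples V E'"
    "\<And>e a. e \<in> E' \<Longrightarrow> a \<in> e \<Longrightarrow> 2 * card V < card {e \<in> E'. a \<in> e}"
    "card E \<le> card E' + 10 * card V ^ 2"
    using full_subsystem G unfolding VE by blast
  interpret full_triples V E' by fact
  have "\<not> contains_copy (V, E') H" using free contains_copy_mono E'(1) unfolding VE by blast
  then have "card E' \<le> 2 * card V ^ 2"
    using H F1_free_empty F7_free_empty[OF _ E'(3)] F3_free_bound by fastforce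
  then show ?thesis using E'(4) unfolding VE by simp
qed

text \<open>
  By injectivity the same vertex of each triple of \<open>H\<close> is sent to the centre \<open>c\<close>, so that vertex
  would lie in all triples of \<open>H\<close>.
\<close>

lemma star_free:
  assumes "\<And>e. e \<in> triples G \<Longrightarrow> c \<in> e"
    and "triples H \<noteq> {}" "\<Inter> (triples H) = {}" "\<And>e. e \<in> triples H \<Longrightarrow> e \<subseteq> verts H"
  shows "\<not> contains_copy G H"
proof
  assume "contains_copy G H"
  then obtain f where f: "inj_on f (verts H)" "\<And>e. e \<in> triples H \<Longrightarrow> f ` e \<in> triples G"
    unfolding contains_copy_def by auto
  have c: "\<exists>u \<in> e. f u = c" if "e \<in> triples H" for e
    using assms(1)[OF f(2)[OF that]] by auto
  obtain e u where u: "e \<in> triples H" "u \<in> e" "f u = c" using assms(2) c by blast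
  have "u \<in> e'" if "e' \<in> triples H" for e'
    using c[OF that] u f(1) assms(4) that by (metis inj_onD subsetD)
  then show False using assms(3) by blast
qed

definition star :: "nat \<Rightarrow> nat triple_sys" where
  "star n = ({..<n}, {e. e \<subseteq> {..<n} \<and> card e = 3 \<and> 0 \<in> e})"

lemma star_avoids:
  assumes "H \<in> special_four_cycles - {F2}"
  shows "\<not> contains_copy (star n) H"
proof (rule star_free)
  show "0 \<in> e" if "e \<in> triples (star n)" for e using that unfolding star_def by simp
  consider "H = F1" | "H = F3" | "H = F4" | "H = F5" | "H = F6" | "H = F7"
    using assms unfolding special_four_cycles_def by blast
  then show "\<Inter> (triples H) = {}"
    by cases (auto simp: F1_def F3_def F4_def F5_def F6_def F7_def special_four_cycle_def)
  obtain v1 v2 v3 v4 w1 w2 w3 w4 where "H = special_four_cycle v1 v2 v3 v4 w1 w2 w3 w4"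
    using assms unfolding special_four_cycles_def F1_def F3_def F4_def F5_def F6_def F7_def
    by blast
  then show "triples H \<noteq> {}" "\<And>e. e \<in> triples H \<Longrightarrow> e \<subseteq> verts H"
    unfolding special_four_cycle_def by auto
qed

lemma card_star: "(n - 1) choose 2 \<le> card (triples (star n))"
proof -
  have "(n - 1) choose 2 = card {P. P \<subseteq> {1..<n} \<and> card P = 2}"
    by (simp add: n_subsets)
  also have "\<dots> \<le> card (triples (star n))"
  proof (rule card_inj_on_le[of "insert 0"])
    show "inj_on (insert 0) {P. P \<subseteq> {1..<n} \<and> card P = 2}"
    proof (rule inj_onI)
      fix P Q :: "nat set"
      assume "P \<in> {P. P \<subseteq> {1..<n} \<and> card P = 2}" "Q \<in> {P. P \<subseteq> {1..<n} \<and> card P = 2}"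
        and eq: "insert 0 P = insert 0 Q"
      then have "0 \<notin> P" "0 \<notin> Q" by fastforce+
      then show "P = Q" using eq by (simp add: insert_ident)
    qed
    show "insert 0 ` {P. P \<subseteq> {1..<n} \<and> card P = 2} \<subseteq> triples (star n)"
    proof clarify
      fix P :: "nat set" assume P: "P \<subseteq> {1..<n}" "card P = 2"
      then have "finite P" "0 \<notin> P" "P \<noteq> {}" by (auto intro: card_ge_0_finite)
      moreover have "insert 0 P \<subseteq> {..<n}" using P(1) \<open>P \<noteq> {}\<close> by fastforce
      ultimately show "insert 0 P \<in> triples (star n)" using P(2) unfolding star_def by simp
    qed
    have "triples (star n) \<subseteq> Pow {..<n}" unfolding star_def by auto
    then show "finite (triples (star n))" by (rule finite_subset) simp
  qed
  finally show ?thesis .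
qed

theorem proposition4:
  fixes \<A> :: "nat triple_sys set"
  assumes "\<A> \<subseteq> special_four_cycles - {F2}"
    and "\<A> \<inter> {F1, F3, F7} \<noteq> {}"
  shows "(\<lambda>n. real (ex_number n \<A>)) \<in> \<Theta>(\<lambda>n. real n ^ 2)"
proof -
  define C where "C n = {card (triples G) | G :: nat triple_sys.
     triple_system G \<and> card (verts G) = n \<and> (\<forall>H \<in> \<A>. \<not> contains_copy G H)}" for n
  have ex: "ex_number n \<A> = Max (C n)" for n unfolding ex_number_def C_def ..
  obtain H where H: "H \<in> \<A>" "H \<in> {F1, F3, F7}" using assms(2) by blast
  have bound: "k \<le> 12 * n ^ 2" if "k \<in> C n" for k n
    using that upper_bound[OF _ H(2)] H(1) unfolding C_def by blast
  then have fin: "finite (C n)" for n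
    by (intro finite_subset[of "C n" "{..12 * n ^ 2}"]) auto
  have star: "card (triples (star n)) \<in> C n" for n
  proof -
    have "triple_system (star n)" "card (verts (star n)) = n"
      unfolding triple_system_def star_def by simp_all
    moreover have "\<forall>H \<in> \<A>. \<not> contains_copy (star n) H" using star_avoids assms(1) by blast
    ultimately show ?thesis unfolding C_def by blast
  qed
  have upper: "ex_number n \<A> \<le> 12 * n ^ 2" for n
  proof -
    have "C n \<noteq> {}" using star by blast
    then show ?thesis unfolding ex using bound Max_in[OF fin] by blast
  qed
  have lower: "(n - 1) choose 2 \<le> ex_number n \<A>" for n
    unfolding ex using Max_ge[OF fin star] card_star order_trans by blast
  have "real n ^ 2 \<le> 8 * real (ex_number n \<A>)" if n4: "n \<ge> 4" for n
  proof -
    obtain m where m: "n = m + 4" using le_Suc_ex[OF n4] by (auto simp: add.commute)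
    have "n ^ 2 \<le> 4 * ((n - 1) * (n - 2))"
      unfolding m by (simp add: power2_eq_square algebra_simps)
    then have "real n ^ 2 \<le> 4 * (real (n - 1) * real (n - 2))"
      by (metis of_nat_le_iff of_nat_mult of_nat_numeral of_nat_power)
    also have "\<dots> = 8 * real ((n - 1) choose 2)"
    proof -
      have "2 * ((n - 1) choose 2) = (n - 1) * (n - 2)"
        unfolding m by (simp add: choose_two)
      then have "real (n - 1) * real (n - 2) = 2 * real ((n - 1) choose 2)"
        by (metis of_nat_mult of_nat_numeral)
      then show ?thesis by simp
    qed
    also have "\<dots> \<le> 8 * real (ex_number n \<A>)" using lower by simp
    finally show ?thesis .
  qed
  then have "(\<lambda>n. real (ex_number n \<A>)) \<in> \<Omega>(\<lambda>n. real n ^ 2)"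
    by (intro landau_omega.bigI[of "1 / 8"]) (auto intro!: eventually_sequentiallyI[of 4] simp: mult.commute)
  moreover have "(\<lambda>n. real (ex_number n \<A>)) \<in> O(\<lambda>n. real n ^ 2)"
  proof (intro landau_o.bigI[of 12] always_eventually allI)
    fix n
    have "real (ex_number n \<A>) \<le> real (12 * n ^ 2)" using upper by (simp only: of_nat_le_iff)
    then show "norm (real (ex_number n \<A>)) \<le> 12 * norm (real n ^ 2)" by simp
  qed simp
  ultimately show ?thesis by (intro bigthetaI)
qed

end
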